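(* Let $n\ge 2$ be an integer and let $a=a_0+\Im(a)\in S_4$. Then the equation $w^n=a$, with unknown $w\in C\ell_2$, has solutions: (i) $w=\sqrt[n]{\dfrac{a_0}{2^{n-1}}}+\dfrac{\Im(a)}{2^{n-1}\Big(\sqrt[n]{\frac{a_0}{2^{n-1}}}\Big)^{n-1}}$ if $a_0\neq 0$ and $n$ is odd; (ii) $w=\sqrt[n]{\dfrac{a_0}{2^{n-1}}}+\dfrac{\Im(a)}{2^{n-1}\Big(\sqrt[n]{\frac{a_0}{2^{n-1}}}\Big)^{n-1}}$ if $a_0>0$ and $n$ is even; (iii) $w\in E_0$ if $a=0$ and $n\ge 2$.
   Context: $C\ell_2=C\ell_{2,0}$ is the associative unital real algebra with $\mathbb{R}$-basis $\mathbf{e}_0=1,\mathbf{e}_1,\mathbf{e}_2,\mathbf{e}_3$ and multiplication rules $\mathbf{e}_1^2=\mathbf{e}_2^2=1$, $\mathbf{e}_3^2=-1$, $\mathbf{e}_1\mathbf{e}_2=\mathbf{e}_3=-\mathbf{e}_2\mathbf{e}_1$, $\mathbf{e}_2\mathbf{e}_3=-\mathbf{e}_1=-\mathbf{e}_3\mathbf{e}_2$, $\mathbf{e}_3\mathbf{e}_1=-\mathbf{e}_2=-\mathbf{e}_1\mathbf{e}_3$. For $a=a_0+a_1\mathbf{e}_1+a_2\mathbf{e}_2+a_3\mathbf{e}_3$ with $a_i\in\mathbb{R}$: $\Im(a)=a_1\mathbf{e}_1+a_2\mathbf{e}_2+a_3\mathbf{e}_3$ and $I_a=a_0^2-a_1^2-a_2^2+a_3^2$.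 $S_4=\{a\in C\ell_2: I_a=0\}$. $E_0=\{\epsilon_1\mathbf{e}_1+\epsilon_2\mathbf{e}_2+\epsilon_3\mathbf{e}_3:\epsilon_i\in\mathbb{R},\ \epsilon_1^2+\epsilon_2^2-\epsilon_3^2=0\}$. $\sqrt[n]{\cdot}$ is the real $n$th root (the nonnegative one if $n$ is even; possibly negative if $n$ is odd). *)

theory Defs
  imports Complex_Main
begin

text \<open>The real Clifford algebra \<open>C\<ell>\<^sub>2\<^sub>,\<^sub>0\<close>, in coordinates with respect to
  \<open>1, e\<^sub>1, e\<^sub>2, e\<^sub>3 = e\<^sub>1 e\<^sub>2\<close>.\<close>

datatype cl2 = Cl2 (co0: real) (co1: real) (co2: real) (co3: real)

lemma cl2_eq_iff:
  "a = b \<longleftrightarrow> co0 a = co0 b \<and> co1 a = co1 b \<and> co2 a = co2 b \<and> co3 a = co3 b"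
  by (cases a; cases b) simp

instantiation cl2 :: real_algebra_1
begin

definition zero_cl2 :: cl2 where "0 = Cl2 0 0 0 0"

definition one_cl2 :: cl2 where "1 = Cl2 1 0 0 0"

definition plus_cl2 :: "cl2 \<Rightarrow> cl2 \<Rightarrow> cl2" where
  "a + b = Cl2 (co0 a + co0 b) (co1 a + co1 b) (co2 a + co2 b) (co3 a + co3 b)"

definition uminus_cl2 :: "cl2 \<Rightarrow> cl2" where
  "- a = Cl2 (- co0 a) (- co1 a) (- co2 a) (- co3 a)"

definition minus_cl2 :: "cl2 \<Rightarrow> cl2 \<Rightarrow> cl2" where
  "a - b = Cl2 (co0 a - co0 b) (co1 a - co1 b) (co2 a - co2 b) (co3 a - co3 b)"

definition scaleR_cl2 :: "real \<Rightarrow> cl2 \<Rightarrow> cl2" where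
  "r *\<^sub>R a = Cl2 (r * co0 a) (r * co1 a) (r * co2 a) (r * co3 a)"

text \<open>The bilinear extension of the multiplication table of the basis vectors, which is
  derived as lemma \<open>cl2_mult_table\<close> below.\<close>

definition times_cl2 :: "cl2 \<Rightarrow> cl2 \<Rightarrow> cl2" where
  "a * b = Cl2
     (co0 a * co0 b + co1 a * co1 b + co2 a * co2 b - co3 a * co3 b)
     (co0 a * co1 b + co1 a * co0 b - co2 a * co3 b + co3 a * co2 b)
     (co0 a * co2 b + co2 a * co0 b + co1 a * co3 b - co3 a * co1 b)
     (co0 a * co3 b + co3 a * co0 b + co1 a * co2 b - co2 a * co1 b)"

instance
  by standard
    (simp_all add: cl2_eq_iff zero_cl2_def one_cl2_def plus_cl2_def uminus_cl2_def
      minus_cl2_def scaleR_cl2_def times_cl2_def algebra_simps)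

end

definition e1 :: cl2 where "e1 = Cl2 0 1 0 0"
definition e2 :: cl2 where "e2 = Cl2 0 0 1 0"
definition e3 :: cl2 where "e3 = Cl2 0 0 0 1"

lemma cl2_mult_table:
  "e1 * e1 = 1" "e2 * e2 = 1" "e3 * e3 = - 1"
  "e1 * e2 = e3" "e2 * e1 = - e3"
  "e2 * e3 = - e1" "e3 * e2 = e1"
  "e3 * e1 = - e2" "e1 * e3 = e2"
  by (simp_all add: e1_def e2_def e3_def times_cl2_def one_cl2_def uminus_cl2_def)

lemma cl2_basis:
  "a = a0 *\<^sub>R 1 + a1 *\<^sub>R e1 + a2 *\<^sub>R e2 + a3 *\<^sub>R e3 \<longleftrightarrow>
     co0 a = a0 \<and> co1 a = a1 \<and> co2 a = a2 \<and> co3 a = a3"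
  by (simp add: cl2_eq_iff e1_def e2_def e3_def one_cl2_def scaleR_cl2_def plus_cl2_def)

definition cl2_Im :: "cl2 \<Rightarrow> cl2" where
  "cl2_Im a = co1 a *\<^sub>R e1 + co2 a *\<^sub>R e2 + co3 a *\<^sub>R e3"

lemma cl2_decomp: "a = of_real (co0 a) + cl2_Im a"
  by (simp add: cl2_Im_def of_real_def cl2_eq_iff e1_def e2_def e3_def one_cl2_def
      scaleR_cl2_def plus_cl2_def)

definition cl2_I :: "cl2 \<Rightarrow> real" where
  "cl2_I a = (co0 a)\<^sup>2 - (co1 a)\<^sup>2 - (co2 a)\<^sup>2 + (co3 a)\<^sup>2"

definition S4 :: "cl2 set" where
  "S4 = {a. cl2_I a = 0}"

definition E0 :: "cl2 set" where
  "E0 = {\<epsilon>1 *\<^sub>R e1 + \<epsilon>2 *\<^sub>R e2 + \<epsilon>3 *\<^sub>R e3 |\<epsilon>1 \<epsilon>2 \<epsilon>3. \<epsilon>1\<^sup>2 + \<epsilon>2\<^sup>2 - \<epsilon>3\<^sup>2 = 0}"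

end

theory Submission
  imports Defs
begin

text \<open>The form \<open>I\<close> is the reduced norm: it is multiplicative, and every \<open>w\<close> satisfies
  \<open>w\<^sup>2 = 2 w\<^sub>0 w - I\<^sub>w\<close>. Hence \<open>w\<^sup>n = a\<close> with \<open>I\<^sub>a = 0\<close> forces \<open>I\<^sub>w = 0\<close>, and then
  \<open>w\<^sup>n = (2 w\<^sub>0)\<^sup>n\<^sup>-\<^sup>1 w\<close>. The scalar part of the equation becomes \<open>2\<^sup>n\<^sup>-\<^sup>1 w\<^sub>0\<^sup>n = a\<^sub>0\<close>, and the
  remaining coordinates are determined by \<open>w = a / (2 w\<^sub>0)\<^sup>n\<^sup>-\<^sup>1\<close>.\<close>

lemma cl2_scaleR_sel [simp]:
  "co0 (r *\<^sub>R a) = r * co0 a" "co1 (r *\<^sub>R a) = r * co1 a"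
  "co2 (r *\<^sub>R a) = r * co2 a" "co3 (r *\<^sub>R a) = r * co3 a"
  by (simp_all add: scaleR_cl2_def)

lemma cl2_I_one: "cl2_I 1 = 1"
  by (simp add: cl2_I_def one_cl2_def)

lemma cl2_I_mult: "cl2_I (a * b) = cl2_I a * cl2_I b"
  by (simp add: cl2_I_def times_cl2_def power2_eq_square algebra_simps)

lemma cl2_I_power: "cl2_I (a ^ n) = cl2_I a ^ n"
  by (induction n) (simp_all add: cl2_I_one cl2_I_mult)

lemma cl2_I_scaleR: "cl2_I (r *\<^sub>R a) = r\<^sup>2 * cl2_I a"
  by (simp add: cl2_I_def power_mult_distrib algebra_simps)

text \<open>Cayley-Hamilton identity with trace \<open>2 * co0 w\<close> and norm
  \<open>cl2_I w\<close>; on null elements squaring becomes a scaling.\<close>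

lemma cl2_square: "w * w = (2 * co0 w) *\<^sub>R w - of_real (cl2_I w)"
  by (simp add: cl2_eq_iff cl2_I_def times_cl2_def of_real_def one_cl2_def minus_cl2_def
      plus_cl2_def power2_eq_square algebra_simps)

text \<open>With \<open>r = co0 w\<close> the left side is the scalar part of \<open>w ^ n\<close>
  for null \<open>w\<close>; the right side isolates \<open>r ^ n\<close>, so that a real root
  solves for \<open>r\<close>.\<close>

lemma double_power_mult:
  fixes r :: real
  assumes "n > 0"
  shows "(2 * r) ^ (n - 1) * r = 2 ^ (n - 1) * r ^ n"
  using assms by (cases n) (simp_all add: power_mult_distrib)

lemma cl2_power_Suc_null:
  assumes "cl2_I w = 0"
  shows "w ^ Suc k = (2 * co0 w) ^ k *\<^sub>R w"
proof (induction k)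
  case (Suc k)
  have "w ^ Suc (Suc k) = w * ((2 * co0 w) ^ k *\<^sub>R w)"
    using Suc by simp
  also have "\<dots> = (2 * co0 w) ^ Suc k *\<^sub>R w"
    by (simp add: cl2_square assms)
  finally show ?case .
qed simp

lemma cl2_power_null:
  assumes "cl2_I w = 0" "n > 0"
  shows "w ^ n = (2 * co0 w) ^ (n - 1) *\<^sub>R w"
  using cl2_power_Suc_null [OF assms(1), of "n - 1"] assms(2) by simp

lemma cl2_I_eq_0_if_power_S4:
  assumes "w ^ n \<in> S4"
  shows "cl2_I w = 0"
  using assms by (simp add: S4_def cl2_I_power)

text \<open>On elements with zero scalar part, the quadratic form defining \<open>E0\<close> is the
  negative of \<open>cl2_I\<close>.\<close>

lemma E0_iff: "w \<in> E0 \<longleftrightarrow> co0 w = 0 \<and> cl2_I w = 0"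
proof -
  have "w \<in> E0 \<longleftrightarrow> co0 w = 0 \<and> (co1 w)\<^sup>2 + (co2 w)\<^sup>2 - (co3 w)\<^sup>2 = 0"
    by (auto simp: E0_def cl2_eq_iff e1_def e2_def e3_def plus_cl2_def)
  then show ?thesis
    by (auto simp: cl2_I_def)
qed

lemma cl2_power_eq_0_iff:
  assumes "n \<ge> 2"
  shows "w ^ n = 0 \<longleftrightarrow> w \<in> E0"
proof
  assume w: "w ^ n = 0"
  then have I: "cl2_I w = 0"
    by (intro cl2_I_eq_0_if_power_S4 [of w n]) (simp add: S4_def cl2_I_def zero_cl2_def)
  then have "(2 * co0 w) ^ (n - 1) *\<^sub>R w = 0"
    using w cl2_power_null [OF I] assms by simp
  then have "co0 w = 0 \<or> w = 0"
    by auto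
  then show "w \<in> E0"
    using I by (auto simp: E0_iff zero_cl2_def)
next
  assume "w \<in> E0"
  then show "w ^ n = 0"
    \<comment> \<open>Here \<open>n \<ge> 2\<close> keeps the exponent \<open>n - 1\<close>
      positive, so the factor \<open>0 ^ (n - 1)\<close> vanishes.\<close>
    using assms by (simp add: E0_iff cl2_power_null)
qed

text \<open>Links the root formula of the theorem to a plain rescaling of \<open>a\<close>: the
  condition on \<open>c\<close> says that \<open>r\<close> is the scalar part of
  \<open>a /\<^sub>R c\<close>.\<close>

lemma of_real_plus_Im_divide:
  assumes "c \<noteq> 0" "c * r = co0 a"
  shows "of_real r + cl2_Im a /\<^sub>R c = a /\<^sub>R c"
proof -
  have "a /\<^sub>R c = of_real (co0 a / c) + cl2_Im a /\<^sub>R c"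
    by (subst cl2_decomp [of a])
      (simp add: scaleR_add_right of_real_def divide_inverse mult.commute)
  also have "co0 a / c = r"
    using assms by (simp add: field_simps)
  finally show ?thesis ..
qed

text \<open>Existence: the rescaled \<open>a\<close> is still null and has scalar part
  \<open>r\<close>, so its \<open>n\<close>-th power multiplies it by exactly the factor that was
  divided out.\<close>

lemma divide_power_eq:
  assumes "a \<in> S4" "n > 0" and r: "2 ^ (n - 1) * r ^ n = co0 a" "r \<noteq> 0"
  shows "(a /\<^sub>R (2 * r) ^ (n - 1)) ^ n = a"
proof -
  define c where "c = (2 * r) ^ (n - 1)"
  have c: "c \<noteq> 0" "c * r = co0 a"
    using r double_power_mult [OF \<open>n > 0\<close>, of r] by (simp_all add: c_def)
  have I: "cl2_I (a /\<^sub>R c) = 0"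
    using assms(1) by (simp add: cl2_I_scaleR S4_def)
  have "co0 (a /\<^sub>R c) = r"
    using c by (simp add: field_simps)
  then have "(a /\<^sub>R c) ^ n = c *\<^sub>R (a /\<^sub>R c)"
    using cl2_power_null [OF I \<open>n > 0\<close>] by (simp add: c_def)
  also have "\<dots> = a"
    using c(1) by simp
  finally show ?thesis
    by (simp only: c_def)
qed

text \<open>Necessity: a nonzero scalar part of \<open>w ^ n\<close> makes the factor
  \<open>(2 * co0 w) ^ (n - 1)\<close> invertible.\<close>

lemma power_eq_imp_divide:
  assumes "w ^ n \<in> S4" "n > 0" "co0 (w ^ n) \<noteq> 0"
  shows "2 ^ (n - 1) * co0 w ^ n = co0 (w ^ n)" "w = w ^ n /\<^sub>R (2 * co0 w) ^ (n - 1)"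
proof -
  have wn: "w ^ n = (2 * co0 w) ^ (n - 1) *\<^sub>R w"
    using assms cl2_I_eq_0_if_power_S4 cl2_power_null by blast
  then show "2 ^ (n - 1) * co0 w ^ n = co0 (w ^ n)"
    using \<open>n > 0\<close> double_power_mult by simp
  define c where "c = (2 * co0 w) ^ (n - 1)"
  have "c \<noteq> 0"
    using assms(3) wn by (auto simp: c_def)
  then have "w = (c *\<^sub>R w) /\<^sub>R c"
    by simp
  then show "w = w ^ n /\<^sub>R (2 * co0 w) ^ (n - 1)"
    by (simp only: wn c_def)
qed

theorem theorem3p4:
  fixes n :: nat and a :: cl2
  assumes "n \<ge> 2" and "a \<in> S4"
  shows
    "(co0 a \<noteq> 0 \<and> odd n \<longrightarrow>
       (\<forall>w. w ^ n = a \<longleftrightarrow>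
          w = of_real (root n (co0 a / 2 ^ (n - 1))) +
              cl2_Im a /\<^sub>R (2 ^ (n - 1) * root n (co0 a / 2 ^ (n - 1)) ^ (n - 1)))) \<and>
     (co0 a > 0 \<and> even n \<longrightarrow>
       (\<forall>w. w = of_real (root n (co0 a / 2 ^ (n - 1))) +
              cl2_Im a /\<^sub>R (2 ^ (n - 1) * root n (co0 a / 2 ^ (n - 1)) ^ (n - 1))
          \<longrightarrow> w ^ n = a)) \<and>
     (a = 0 \<longrightarrow> (\<forall>w. w ^ n = a \<longleftrightarrow> w \<in> E0))"
proof -
  define r where "r = root n (co0 a / 2 ^ (n - 1))"
  have n: "n > 0"
    using assms(1) by simp
  have sol: "of_real r + cl2_Im a /\<^sub>R (2 ^ (n - 1) * r ^ (n - 1)) = a /\<^sub>R (2 * r) ^ (n - 1)"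
    and pow: "(a /\<^sub>R (2 * r) ^ (n - 1)) ^ n = a"
    if "co0 a \<noteq> 0" "odd n \<or> co0 a > 0"
  proof -
    \<comment> \<open>\<open>root n\<close> inverts the power on all reals for odd \<open>n\<close>,
      and on nonnegative ones for even \<open>n\<close>.\<close>
    have "r ^ n = co0 a / 2 ^ (n - 1)"
      using that n by (auto simp: r_def odd_real_root_pow)
    then have r: "2 ^ (n - 1) * r ^ n = co0 a"
      by simp
    then have "r \<noteq> 0"
      using that n by (auto simp: zero_power)
    then show "(a /\<^sub>R (2 * r) ^ (n - 1)) ^ n = a"
      using divide_power_eq assms(2) n r by blast
    show "of_real r + cl2_Im a /\<^sub>R (2 ^ (n - 1) * r ^ (n - 1)) = a /\<^sub>R (2 * r) ^ (n - 1)"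
      using of_real_plus_Im_divide [of "(2 * r) ^ (n - 1)" r a] \<open>r \<noteq> 0\<close> r
        double_power_mult [OF n, of r]
      by (simp add: power_mult_distrib)
  qed
  \<comment> \<open>Odd powers are injective on the reals, which fixes \<open>co0 w\<close>; for
    even \<open>n\<close>, \<open>- w\<close> is a second solution.\<close>
  have unique: "w = a /\<^sub>R (2 * r) ^ (n - 1)" if "co0 a \<noteq> 0" "odd n" "w ^ n = a" for w
  proof -
    have w: "2 ^ (n - 1) * co0 w ^ n = co0 a" "w = a /\<^sub>R (2 * co0 w) ^ (n - 1)"
      using power_eq_imp_divide [of w n] that assms(2) n by auto
    have "co0 a / 2 ^ (n - 1) = co0 w ^ n"
      using w(1) by (simp add: field_simps)
    then have "r = co0 w"
      using \<open>odd n\<close> by (simp add: r_def odd_real_root_power_cancel)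
    then show ?thesis
      using w(2) by simp
  qed
  show ?thesis
    unfolding r_def [symmetric]
    using sol pow unique cl2_power_eq_0_iff [OF assms(1)] by auto
qed

end
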